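(* Let $\mathbb{k}$ be an algebraically closed field, let $p,q\in\mathbb{k}^*$ with $pq\neq1$ be primitive $m$-th and $n$-th roots of unity, respectively, and let $l=\operatorname{lcm}(m,n)$. For every $(\mu,\lambda)\in(\mathbb{k}^* )^2$, the right $\mathcal{H}_{p,q}$-module $\mathcal{V}_2(\mu,\lambda)$ is a simple module of dimension $l$.
   Context: For $p,q\in\mathbb{k}^*=\mathbb{k}\setminus\{0\}$, $\mathcal{H}_{p,q}$ is the $\mathbb{k}$-algebra generated by $x,y,z$ subject to the relations $zx=p^{-1}xz$, $zy=pyz$, $yx-qxy=z$. All modules are right modules. Put $[k]_{p,q}:=\frac{q^k-p^{-k}}{q-p^{-1}}=\sum_{i=0}^{k-1}q^ip^{-(k-1-i)}$. $\mathcal{V}_2(\mu,\lambda)$ is the $\mathbb{k}$-vector space with basis $\{v_k\mid 0\le k\le l-1\}$ and right $\mathcal{H}_{p,q}$-module structure given by $$v_kz=p^{-k}\lambda v_k,\qquad v_ky=\begin{cases}\mu v_{k+1},&0\le k\le l-2\\ \mu v_0,&k=l-1,\end{cases}\qquad v_kx=\begin{cases}\mu^{-1}\lambda[k]_{p,q}v_{k-1},&1\le k\le l-1\\ 0,&k=0.\end{cases}$$ *)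

theory Defs
  imports
    "HOL-Library.Poly_Mapping"
    "HOL-Algebra.QuotRing"
    "Jordan_Normal_Form.VS_Connect"
begin

section \<open>Algebras given by generators and relations\<close>

text \<open>The \<open>algebra\<close> locale of HOL-Algebra is restricted to commutative algebras. A
  unital associative algebra is, as there, a record of type \<open>module\<close>.\<close>

locale assoc_algebra = Module.module R M + M?: ring M for R (structure) and M (structure) +
  assumes smult_mult_left:
      "\<lbrakk>c \<in> carrier R; a \<in> carrier M; b \<in> carrier M\<rbrakk> \<Longrightarrow>
        (c \<odot>\<^bsub>M\<^esub> a) \<otimes>\<^bsub>M\<^esub> b = c \<odot>\<^bsub>M\<^esub> (a \<otimes>\<^bsub>M\<^esub> b)"
    and smult_mult_right:
      "\<lbrakk>c \<in> carrier R; a \<in> carrier M; b \<in> carrier M\<rbrakk> \<Longrightarrow>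
        a \<otimes>\<^bsub>M\<^esub> (c \<odot>\<^bsub>M\<^esub> b) = c \<odot>\<^bsub>M\<^esub> (a \<otimes>\<^bsub>M\<^esub> b)"

text \<open>Words form the free monoid under concatenation, written additively because the
  product of \<open>poly_mapping\<close> is convolution with respect to addition of the keys. Hence
  \<open>'g fword \<Rightarrow>\<^sub>0 'k\<close> is the free algebra on \<open>'g\<close> over \<open>'k\<close>.\<close>

datatype 'g fword = FWord (letters: "'g list")

instantiation fword :: (type) monoid_add
begin

definition zero_fword :: "'g fword" where
  "zero_fword = FWord []"

definition plus_fword :: "'g fword \<Rightarrow> 'g fword \<Rightarrow> 'g fword" where
  "plus_fword u w = FWord (letters u @ letters w)"

instance
  by standard (simp_all add: zero_fword_def plus_fword_def)

end

definition free_gen :: "'g \<Rightarrow> ('g fword \<Rightarrow>\<^sub>0 'k::comm_ring_1)" where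
  "free_gen g = Poly_Mapping.single (FWord [g]) 1"

definition free_scale ::
    "'k::comm_ring_1 \<Rightarrow> ('g fword \<Rightarrow>\<^sub>0 'k) \<Rightarrow> ('g fword \<Rightarrow>\<^sub>0 'k)" where
  "free_scale c a = Poly_Mapping.single 0 c * a"

definition free_algebra :: "('k::comm_ring_1, 'g fword \<Rightarrow>\<^sub>0 'k) module" where
  "free_algebra =
    \<lparr>carrier = UNIV, mult = (*), one = 1, zero = 0, add = (+), smult = free_scale\<rparr>"

definition quotient_algebra ::
    "('k, 'a) module \<Rightarrow> 'a set \<Rightarrow> ('k, 'a set) module" where
  "quotient_algebra A I =
    \<lparr>carrier = carrier (A Quot I), mult = mult (A Quot I), one = one (A Quot I),
     zero = zero (A Quot I), add = add (A Quot I),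
     smult = (\<lambda>c C. \<Union>a\<in>C. I +>\<^bsub>A\<^esub> (c \<odot>\<^bsub>A\<^esub> a))\<rparr>"

text \<open>Ideals of HOL-Algebra are two-sided. A relation \<open>a = b\<close> is given as the
  relator \<open>a - b\<close>.\<close>

definition presented_algebra ::
    "('g fword \<Rightarrow>\<^sub>0 'k::comm_ring_1) set \<Rightarrow> ('k, ('g fword \<Rightarrow>\<^sub>0 'k) set) module" where
  "presented_algebra rels = quotient_algebra free_algebra (Idl\<^bsub>free_algebra\<^esub> rels)"

section \<open>Right modules\<close>

text \<open>The \<open>K\<close>-linear structure of \<open>M\<close> is a component of \<open>M\<close>; \<open>smult_compat\<close> says that
  it agrees with the one induced by \<open>A\<close>.\<close>

locale right_module =
  fixes K :: "'k ring" and A :: "('k, 'a) module" and M :: "('k, 'm) module"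
    and act :: "'m \<Rightarrow> 'a \<Rightarrow> 'm"
  assumes algebra: "assoc_algebra K A"
    and module: "Module.module K M"
    and act_closed: "\<lbrakk>v \<in> carrier M; a \<in> carrier A\<rbrakk> \<Longrightarrow> act v a \<in> carrier M"
    and act_add_left: "\<lbrakk>v \<in> carrier M; w \<in> carrier M; a \<in> carrier A\<rbrakk> \<Longrightarrow>
      act (v \<oplus>\<^bsub>M\<^esub> w) a = act v a \<oplus>\<^bsub>M\<^esub> act w a"
    and act_add_right: "\<lbrakk>v \<in> carrier M; a \<in> carrier A; b \<in> carrier A\<rbrakk> \<Longrightarrow>
      act v (a \<oplus>\<^bsub>A\<^esub> b) = act v a \<oplus>\<^bsub>M\<^esub> act v b"
    and act_mult: "\<lbrakk>v \<in> carrier M; a \<in> carrier A; b \<in> carrier A\<rbrakk> \<Longrightarrow>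
      act v (a \<otimes>\<^bsub>A\<^esub> b) = act (act v a) b"
    and act_one: "v \<in> carrier M \<Longrightarrow> act v \<one>\<^bsub>A\<^esub> = v"
    and smult_compat: "\<lbrakk>c \<in> carrier K; v \<in> carrier M\<rbrakk> \<Longrightarrow>
      act v (c \<odot>\<^bsub>A\<^esub> \<one>\<^bsub>A\<^esub>) = c \<odot>\<^bsub>M\<^esub> v"

definition right_submodule ::
    "'m set \<Rightarrow> ('k, 'a) module \<Rightarrow> ('k, 'm) module \<Rightarrow> ('m \<Rightarrow> 'a \<Rightarrow> 'm) \<Rightarrow> bool" where
  "right_submodule N A M act \<longleftrightarrow>
    additive_subgroup N M \<and> (\<forall>v\<in>N. \<forall>a\<in>carrier A. act v a \<in> N)"

locale simple_right_module = right_module +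
  assumes nonzero: "carrier M \<noteq> {\<zero>\<^bsub>M\<^esub>}"
    and no_proper_submodule:
      "right_submodule N A M act \<Longrightarrow> N = {\<zero>\<^bsub>M\<^esub>} \<or> N = carrier M"

text \<open>A map \<open>op\<close> assigning to each generator a linear operator, acting from the right,
  extends to the free algebra: a word acts by its letters from left to right, i.e.
  \<open>v \<cdot> (g h) = (v \<cdot> g) \<cdot> h\<close>. A coset in a presented algebra acts through a
  representative; when all relators act as zero the choice is irrelevant.\<close>

definition free_action ::
    "('k, 'm) module \<Rightarrow> ('g \<Rightarrow> 'm \<Rightarrow> 'm) \<Rightarrow> 'm \<Rightarrow> ('g fword \<Rightarrow>\<^sub>0 'k::comm_ring_1) \<Rightarrow> 'm" where
  "free_action M op v a =
    (\<Oplus>\<^bsub>M\<^esub>w\<in>Poly_Mapping.keys a.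
      Poly_Mapping.lookup a w \<odot>\<^bsub>M\<^esub> foldl (\<lambda>u g. op g u) v (letters w))"

definition presented_action ::
    "('k, 'm) module \<Rightarrow> ('g \<Rightarrow> 'm \<Rightarrow> 'm) \<Rightarrow> 'm \<Rightarrow> ('g fword \<Rightarrow>\<^sub>0 'k::comm_ring_1) set \<Rightarrow> 'm" where
  "presented_action M op v C = free_action M op v (SOME a. a \<in> C)"

section \<open>The algebra \<open>H p q\<close>\<close>

datatype gen = X | Y | Z

definition H :: "'k::field \<Rightarrow> 'k \<Rightarrow> ('k, (gen fword \<Rightarrow>\<^sub>0 'k) set) module" where
  "H p q = presented_algebra
    {free_gen Z * free_gen X - free_scale (inverse p) (free_gen X * free_gen Z),
     free_gen Z * free_gen Y - free_scale p (free_gen Y * free_gen Z),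
     free_gen Y * free_gen X - free_scale q (free_gen X * free_gen Y) - free_gen Z}"

definition pq_number :: "'k::field \<Rightarrow> 'k \<Rightarrow> nat \<Rightarrow> 'k" where
  "pq_number p q k = (q ^ k - inverse p ^ k) / (q - inverse p)"

definition primitive_root_of_unity :: "nat \<Rightarrow> 'k::field \<Rightarrow> bool" where
  "primitive_root_of_unity n a \<longleftrightarrow> n > 0 \<and> a ^ n = 1 \<and> (\<forall>k. 0 < k \<and> k < n \<longrightarrow> a ^ k \<noteq> 1)"

section \<open>The right module \<open>V2\<close>\<close>

text \<open>The basis vector \<open>v k\<close> is \<open>unit_vec l k\<close>, for \<open>k < l\<close>.\<close>

abbreviation V2 :: "nat \<Rightarrow> ('k::field, 'k vec) module" where
  "V2 l \<equiv> module_vec TYPE('k) l"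

fun V2_basis_action :: "'k::field \<Rightarrow> 'k \<Rightarrow> nat \<Rightarrow> 'k \<Rightarrow> 'k \<Rightarrow> gen \<Rightarrow> nat \<Rightarrow> 'k vec" where
  "V2_basis_action p q l \<mu> lam Z k = (inverse p ^ k * lam) \<cdot>\<^sub>v unit_vec l k"
| "V2_basis_action p q l \<mu> lam Y k =
    (if k = l - 1 then \<mu> \<cdot>\<^sub>v unit_vec l 0 else \<mu> \<cdot>\<^sub>v unit_vec l (k + 1))"
| "V2_basis_action p q l \<mu> lam X k =
    (if k = 0 then 0\<^sub>v l else (inverse \<mu> * lam * pq_number p q k) \<cdot>\<^sub>v unit_vec l (k - 1))"

definition V2_operator :: "'k::field \<Rightarrow> 'k \<Rightarrow> nat \<Rightarrow> 'k \<Rightarrow> 'k \<Rightarrow> gen \<Rightarrow> 'k vec \<Rightarrow> 'k vec" where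
  "V2_operator p q l \<mu> lam g v =
    (\<Oplus>\<^bsub>V2 l\<^esub>k\<in>{..<l}. (v $ k) \<odot>\<^bsub>V2 l\<^esub> V2_basis_action p q l \<mu> lam g k)"

definition V2_action ::
    "'k::field \<Rightarrow> 'k \<Rightarrow> nat \<Rightarrow> 'k \<Rightarrow> 'k \<Rightarrow> 'k vec \<Rightarrow> (gen fword \<Rightarrow>\<^sub>0 'k) set \<Rightarrow> 'k vec" where
  "V2_action p q l \<mu> lam = presented_action (V2 l) (V2_operator p q l \<mu> lam)"

end

theory Submission
  imports Defs
begin

text \<open>The operators by which \<open>z\<close> and \<open>xy\<close> act are diagonal in the basis \<open>v k\<close>, with eigenvalues
  \<open>p\<^sup>-\<^sup>k \<lambda>\<close> and \<open>[k] \<lambda>\<close>. As \<open>pq \<noteq> 1\<close>, the pair of eigenvalues determines \<open>(p\<^sup>k, q\<^sup>k)\<close>, hence \<open>k\<close>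
  modulo \<open>l\<close>, so a nonzero vector of minimal support in a submodule is a multiple of some
  \<open>v k\<close>. Since \<open>y\<close> permutes the basis cyclically up to the nonzero factor \<open>\<mu>\<close>, the submodule is everything.\<close>

section \<open>Presented algebras\<close>

locale algebra_ideal = A?: assoc_algebra K R + I?: ideal I R
  for I :: "'a set" and R :: "('k, 'a) module" (structure) and K :: "'k ring"
begin

lemmas abelian_group_R = ring.is_abelian_group[OF ideal.axioms(2)[OF is_ideal]]

text \<open>In the quotient a scalar multiple is a union over all representatives. For
  \<open>h\<close> in \<open>I\<close>, \<open>c \<odot> h = (c \<odot> \<one>) \<otimes> h\<close>
  lies in \<open>I\<close> again, so every representative contributes the same coset and the union
  collapses to it.\<close>

lemma smult_coset:
  assumes c: "c \<in> carrier K" and a: "a \<in> carrier R"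
  shows "c \<odot>\<^bsub>quotient_algebra R I\<^esub> (I +> a) = I +> (c \<odot> a)"
proof -
  have smult_eq: "c \<odot> b = (c \<odot> \<one>) \<otimes> b" if "b \<in> carrier R" for b
    using smult_mult_left[OF c _ that, of \<one>] that by simp
  have coset_eq: "I +> (c \<odot> b) = I +> (c \<odot> a)" if b: "b \<in> I +> a" for b
  proof -
    obtain h where h: "h \<in> I" "b = h \<oplus> a"
      using b by (auto simp: a_r_coset_def r_coset_def)
    have "c \<odot> h \<in> I"
      using smult_eq[OF a_Hcarr[OF h(1)]] I_l_closed[OF h(1), of "c \<odot> \<one>"] c by simp
    moreover have "c \<odot> b = c \<odot> h \<oplus> c \<odot> a"
      using h a c a_Hcarr by (simp add: smult_r_distr)
    ultimately have "c \<odot> b \<in> I +> (c \<odot> a)"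
      by (auto simp: a_r_coset_def r_coset_def)
    then show ?thesis
      using abelian_group.a_repr_independence[OF abelian_group_R _ _ a_subgroup] a c
      by (metis smult_closed)
  qed
  moreover have "a \<in> I +> a"
    by (rule a_rcos_self[OF a])
  ultimately have "(\<Union>b\<in>I +> a. I +> (c \<odot> b)) = I +> (c \<odot> a)"
    by blast
  then show ?thesis
    by (simp add: quotient_algebra_def)
qed

lemma quotient_algebra_simps:
  "carrier (quotient_algebra R I) = a_rcosets I"
  "\<one>\<^bsub>quotient_algebra R I\<^esub> = I +> \<one>"
  "\<zero>\<^bsub>quotient_algebra R I\<^esub> = I"
  "a \<in> carrier R \<Longrightarrow> b \<in> carrier R \<Longrightarrow>
    (I +> a) \<oplus>\<^bsub>quotient_algebra R I\<^esub> (I +> b) = I +> (a \<oplus> b)"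
  "a \<in> carrier R \<Longrightarrow> b \<in> carrier R \<Longrightarrow>
    (I +> a) \<otimes>\<^bsub>quotient_algebra R I\<^esub> (I +> b) = I +> (a \<otimes> b)"
  by (simp_all add: quotient_algebra_def FactRing_def rcoset_mult_add a_rcos_sum)

lemma coset_closed: "a \<in> carrier R \<Longrightarrow> I +> a \<in> carrier (quotient_algebra R I)"
  by (simp add: quotient_algebra_simps abelian_group.a_rcosetsI[OF abelian_group_R a_subset])

lemma quotient_algebra_carrierE:
  assumes "C \<in> carrier (quotient_algebra R I)"
  obtains a where "a \<in> carrier R" "C = I +> a"
  using assms by (auto simp: quotient_algebra_simps A_RCOSETS_def')

text \<open>The ring operations are those of \<open>R Quot I\<close>, only stored in a record that
  also has a scalar multiplication. The identity map is thus a ring homomorphism, and its image ring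
  is the quotient algebra.\<close>

lemma quotient_algebra_is_ring: "ring (quotient_algebra R I)"
proof -
  have "id \<in> Ring.ring_hom (R Quot I) (quotient_algebra R I)"
    by (rule ring_hom_memI) (simp_all add: quotient_algebra_def
        ring.ring_simprules[OF quotient_is_ring])
  from ring.ring_hom_imp_img_ring[OF quotient_is_ring this] show ?thesis
    by (simp add: quotient_algebra_def)
qed

lemma assoc_algebra_quotient:
  "assoc_algebra K (quotient_algebra R I)"
proof -
  interpret Q: ring "quotient_algebra R I" by (rule quotient_algebra_is_ring)
  note coset_simps = smult_coset quotient_algebra_simps(2-) coset_closed
  have "Module.module K (quotient_algebra R I)"
    by (rule moduleI; (elim quotient_algebra_carrierE)?)
      (simp_all add: R.is_cring Q.is_abelian_group coset_simps smult_l_distr smult_r_distr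
        smult_assoc1)
  moreover have "assoc_algebra_axioms K (quotient_algebra R I)"
    by (rule assoc_algebra_axioms.intro; elim quotient_algebra_carrierE)
      (simp_all add: coset_simps smult_mult_left smult_mult_right)
  ultimately show ?thesis
    by (simp add: assoc_algebra_def Q.ring_axioms)
qed

end

section \<open>The free algebra as an associative algebra\<close>

lemma free_algebra_simps [simp]:
  "carrier free_algebra = UNIV"
  "\<one>\<^bsub>free_algebra\<^esub> = 1"
  "\<zero>\<^bsub>free_algebra\<^esub> = 0"
  "a \<oplus>\<^bsub>free_algebra\<^esub> b = a + b"
  "a \<otimes>\<^bsub>free_algebra\<^esub> b = a * b"
  "c \<odot>\<^bsub>free_algebra\<^esub> a = free_scale c a"
  by (simp_all add: free_algebra_def)

lemma ring_free_algebra: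
  "ring (free_algebra :: ('k::comm_ring_1, 'g fword \<Rightarrow>\<^sub>0 'k) module)"
proof (rule ringI)
  show "abelian_group (free_algebra :: ('k, 'g fword \<Rightarrow>\<^sub>0 'k) module)"
    by (rule abelian_groupI) (auto simp: algebra_simps intro: exI[of _ "- _"])
  show "Group.monoid (free_algebra :: ('k, 'g fword \<Rightarrow>\<^sub>0 'k) module)"
    by (rule monoidI) (auto simp: mult.assoc)
qed (auto simp: algebra_simps)

text \<open>Updating at a key outside the support amounts to adding a single term. Statements
  additive in \<open>a\<close> thereby reduce to monomials.\<close>

lemma poly_mapping_induct_single [case_names zero add]:
  assumes "P 0"
    and "\<And>a w c. P a \<Longrightarrow> P (a + Poly_Mapping.single w c)"
  shows "P a"
proof (induction a rule: update_induct)
  case const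
  show ?case by (rule assms(1))
next
  case (update f w c)
  have "Poly_Mapping.update w c f = f + Poly_Mapping.single w c"
    using update(1)
    by (intro poly_mapping_eqI) (auto simp: lookup_update lookup_add lookup_single in_keys_iff when_def)
  then show ?case
    using assms(2)[OF update(3)] by simp
qed

text \<open>Constants are central because the empty word is neutral for concatenation on both sides
  and coefficients commute. This makes \<open>free_scale\<close> compatible with the right factor of
  a product.\<close>

lemma single_zero_mult_commute:
  "a * Poly_Mapping.single 0 c = Poly_Mapping.single 0 c * a"
  for a :: "'g::monoid_add \<Rightarrow>\<^sub>0 'k::comm_ring_1"
  by (induction a rule: poly_mapping_induct_single)
    (simp_all add: algebra_simps mult_single)

lemma assoc_algebra_free_algebra:
  "assoc_algebra class_ring (free_algebra :: ('k::comm_ring_1, 'g fword \<Rightarrow>\<^sub>0 'k) module)"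
proof -
  interpret ring "free_algebra :: ('k, 'g fword \<Rightarrow>\<^sub>0 'k) module"
    by (rule ring_free_algebra)
  have "Module.module class_ring (free_algebra :: ('k, 'g fword \<Rightarrow>\<^sub>0 'k) module)"
    by (rule moduleI)
      (simp_all add: class_cring.is_cring is_abelian_group free_scale_def class_ring_simps
        single_add algebra_simps mult_single flip: mult.assoc)
  moreover have "assoc_algebra_axioms class_ring (free_algebra :: ('k, 'g fword \<Rightarrow>\<^sub>0 'k) module)"
    by unfold_locales
      (simp_all add: free_scale_def mult.assoc, simp flip: mult.assoc add: single_zero_mult_commute)
  ultimately show ?thesis
    by (simp add: assoc_algebra_def ring_axioms)
qed

lemma letters_zero [simp]: "letters 0 = []"
  by (simp add: zero_fword_def)

section \<open>Right modules over presented algebras\<close>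

locale free_algebra_operators =
  Module.module "class_ring :: 'k ring" M for M :: "('k::comm_ring_1, 'm) module" +
  fixes op :: "'g \<Rightarrow> 'm \<Rightarrow> 'm"
  assumes op_closed: "v \<in> carrier M \<Longrightarrow> op g v \<in> carrier M"
    and op_add: "\<lbrakk>v \<in> carrier M; w \<in> carrier M\<rbrakk> \<Longrightarrow> op g (v \<oplus>\<^bsub>M\<^esub> w) = op g v \<oplus>\<^bsub>M\<^esub> op g w"
    and op_smult: "v \<in> carrier M \<Longrightarrow> op g (c \<odot>\<^bsub>M\<^esub> v) = c \<odot>\<^bsub>M\<^esub> op g v"
begin

abbreviation word_action :: "'m \<Rightarrow> 'g fword \<Rightarrow> 'm" where
  "word_action v w \<equiv> foldl (\<lambda>u g. op g u) v (letters w)"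

abbreviation action :: "'m \<Rightarrow> ('g fword \<Rightarrow>\<^sub>0 'k) \<Rightarrow> 'm" where
  "action \<equiv> free_action M op"

lemma carrier_class_ring [simp]: "c \<in> carrier class_ring"
  by (simp add: class_ring_simps)

lemma foldl_op_closed: "v \<in> carrier M \<Longrightarrow> foldl (\<lambda>u g. op g u) v gs \<in> carrier M"
  by (induction gs arbitrary: v) (simp_all add: op_closed)

lemma foldl_op_add: "\<lbrakk>v \<in> carrier M; w \<in> carrier M\<rbrakk> \<Longrightarrow>
    foldl (\<lambda>u g. op g u) (v \<oplus>\<^bsub>M\<^esub> w) gs
      = foldl (\<lambda>u g. op g u) v gs \<oplus>\<^bsub>M\<^esub> foldl (\<lambda>u g. op g u) w gs"
  by (induction gs arbitrary: v w) (simp_all add: op_closed op_add)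

lemma foldl_op_smult: "v \<in> carrier M \<Longrightarrow>
    foldl (\<lambda>u g. op g u) (c \<odot>\<^bsub>M\<^esub> v) gs = c \<odot>\<^bsub>M\<^esub> foldl (\<lambda>u g. op g u) v gs"
  by (induction gs arbitrary: v) (simp_all add: op_closed op_smult)

text \<open>Words outside the support contribute zero. Summing over a common finite set lets actions
  of elements with different supports be compared term by term.\<close>

lemma action_superset:
  assumes "finite S" "Poly_Mapping.keys a \<subseteq> S" "v \<in> carrier M"
  shows "action v a = (\<Oplus>\<^bsub>M\<^esub>w\<in>S. Poly_Mapping.lookup a w \<odot>\<^bsub>M\<^esub> word_action v w)"
  unfolding free_action_def using assms
  by (intro M.add.finprod_mono_neutral_cong_left)
    (auto simp: in_keys_iff foldl_op_closed smult_l_null[unfolded class_ring_simps, simplified])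

lemma action_closed: "v \<in> carrier M \<Longrightarrow> action v a \<in> carrier M"
  unfolding free_action_def by (intro M.finsum_closed) (auto simp: foldl_op_closed)

lemma action_zero: "action v 0 = \<zero>\<^bsub>M\<^esub>"
  by (simp add: free_action_def)

lemma action_single:
  assumes "v \<in> carrier M"
  shows "action v (Poly_Mapping.single w c) = c \<odot>\<^bsub>M\<^esub> word_action v w"
  using action_superset[of "{w}" "Poly_Mapping.single w c" v] assms
  by (simp add: foldl_op_closed)

lemma action_add_right:
  assumes v: "v \<in> carrier M"
  shows "action v (a + b) = action v a \<oplus>\<^bsub>M\<^esub> action v b"
proof -
  let ?S = "Poly_Mapping.keys a \<union> Poly_Mapping.keys b"
  have "action v (a + b)
      = (\<Oplus>\<^bsub>M\<^esub>w\<in>?S. Poly_Mapping.lookup (a + b) w \<odot>\<^bsub>M\<^esub> word_action v w)"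
    using v keys_add[of a b] by (intro action_superset) auto
  also have "\<dots> = (\<Oplus>\<^bsub>M\<^esub>w\<in>?S. Poly_Mapping.lookup a w \<odot>\<^bsub>M\<^esub> word_action v w
      \<oplus>\<^bsub>M\<^esub> Poly_Mapping.lookup b w \<odot>\<^bsub>M\<^esub> word_action v w)"
    using v smult_l_distr
    by (intro M.finsum_cong') (auto simp: lookup_add foldl_op_closed class_ring_simps)
  also have "\<dots> = (\<Oplus>\<^bsub>M\<^esub>w\<in>?S. Poly_Mapping.lookup a w \<odot>\<^bsub>M\<^esub> word_action v w)
      \<oplus>\<^bsub>M\<^esub> (\<Oplus>\<^bsub>M\<^esub>w\<in>?S. Poly_Mapping.lookup b w \<odot>\<^bsub>M\<^esub> word_action v w)"
    using v by (intro M.finsum_addf) (auto simp: foldl_op_closed)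
  also have "\<dots> = action v a \<oplus>\<^bsub>M\<^esub> action v b"
    using v by (simp add: action_superset[symmetric])
  finally show ?thesis .
qed

lemma action_add_left:
  assumes "v \<in> carrier M" "w \<in> carrier M"
  shows "action (v \<oplus>\<^bsub>M\<^esub> w) a = action v a \<oplus>\<^bsub>M\<^esub> action w a"
proof -
  have "action (v \<oplus>\<^bsub>M\<^esub> w) a = (\<Oplus>\<^bsub>M\<^esub>u\<in>Poly_Mapping.keys a.
      Poly_Mapping.lookup a u \<odot>\<^bsub>M\<^esub> word_action v u \<oplus>\<^bsub>M\<^esub> Poly_Mapping.lookup a u \<odot>\<^bsub>M\<^esub> word_action w u)"
    unfolding free_action_def using assms
    by (intro M.finsum_cong') (auto simp: foldl_op_closed foldl_op_add smult_r_distr)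
  also have "\<dots> = action v a \<oplus>\<^bsub>M\<^esub> action w a"
    unfolding free_action_def using assms
    by (intro M.finsum_addf) (auto simp: foldl_op_closed)
  finally show ?thesis .
qed

lemma action_smult_left:
  assumes "v \<in> carrier M"
  shows "action (c \<odot>\<^bsub>M\<^esub> v) a = c \<odot>\<^bsub>M\<^esub> action v a"
proof (induction a rule: poly_mapping_induct_single)
  case zero
  show ?case by (simp add: action_zero)
next
  case (add a w d)
  have "d \<odot>\<^bsub>M\<^esub> (c \<odot>\<^bsub>M\<^esub> u) = c \<odot>\<^bsub>M\<^esub> (d \<odot>\<^bsub>M\<^esub> u)" if "u \<in> carrier M" for u
    using smult_assoc1[of c d u] smult_assoc1[of d c u] that
    by (simp add: class_ring_simps mult.commute)
  then show ?case
    using assms add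
    by (simp add: action_add_right action_single foldl_op_smult smult_r_distr action_closed
        foldl_op_closed)
qed

lemma action_zero_left: "action \<zero>\<^bsub>M\<^esub> a = \<zero>\<^bsub>M\<^esub>"
  using action_smult_left[of "\<zero>\<^bsub>M\<^esub>" 0 a] smult_l_null[of "action \<zero>\<^bsub>M\<^esub> a"] smult_r_null[of 0]
  by (simp add: class_ring_simps action_closed)

text \<open>Both sides are additive in \<open>a\<close> and in \<open>b\<close>, which leaves two
  monomials. There, folding over a concatenation is folding twice, and scalars pass through the
  operators by linearity.\<close>

lemma action_mult:
  assumes v: "v \<in> carrier M"
  shows "action v (a * b) = action (action v a) b"
proof (induction a rule: poly_mapping_induct_single)
  case zero
  show ?case by (simp add: action_zero action_zero_left)
next
  case (add a w c)
  have "action v (Poly_Mapping.single w c * b) = action (action v (Poly_Mapping.single w c)) b"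
  proof (induction b rule: poly_mapping_induct_single)
    case zero
    show ?case by (simp add: action_zero)
  next
    case (add b u d)
    have "word_action v (w + u) = word_action (word_action v w) u"
      by (simp add: plus_fword_def)
    then have "action v (Poly_Mapping.single w c * Poly_Mapping.single u d)
        = action (action v (Poly_Mapping.single w c)) (Poly_Mapping.single u d)"
      using v smult_assoc1[of c d "word_action v (w + u)"]
        smult_assoc1[of d c "word_action v (w + u)"]
      by (simp add: mult_single action_single foldl_op_closed foldl_op_smult class_ring_simps
          mult.commute)
    then show ?case
      using add v by (simp add: distrib_left action_add_right action_closed)
  qed
  then show ?case
    using add v by (simp add: distrib_right action_add_right action_add_left action_closed)
qed

lemma action_one: "v \<in> carrier M \<Longrightarrow> action v 1 = v"
  using action_single[of v 0 1] smult_one[of v] by (simp add: class_ring_simps)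

lemma action_free_scale: "v \<in> carrier M \<Longrightarrow> action v (free_scale c a) = c \<odot>\<^bsub>M\<^esub> action v a"
  by (simp add: free_scale_def action_mult action_single action_smult_left)

lemma action_free_gen: "v \<in> carrier M \<Longrightarrow> action v (free_gen g) = op g v"
  using smult_one[of "op g v"]
  by (simp add: free_gen_def action_single class_ring_simps op_closed)

lemma action_uminus:
  assumes "v \<in> carrier M"
  shows "action v (- a) = \<ominus>\<^bsub>M\<^esub> action v a"
  using action_add_right[OF assms, of "- a" a] assms
  by (intro M.minus_equality[symmetric]) (simp_all add: action_zero action_closed)

lemma action_diff:
  assumes "v \<in> carrier M"
  shows "action v (a - b) = action v a \<ominus>\<^bsub>M\<^esub> action v b"
  using action_add_right[OF assms, of a "- b"] assms
  by (simp add: action_uminus M.minus_eq)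

text \<open>For \<open>a * x\<close>, \<open>x\<close> acts on zero; for \<open>x * a\<close>,
  \<open>a\<close> acts on \<open>action v x\<close>, again a vector of \<open>M\<close>. The second
  case is why the annihilator of the whole module is taken and not that of one vector.\<close>

lemma ideal_annihilator: "ideal {a. \<forall>v\<in>carrier M. action v a = \<zero>\<^bsub>M\<^esub>} free_algebra"
proof (rule idealI[OF ring_free_algebra])
  have inv_eq: "inv\<^bsub>add_monoid free_algebra\<^esub> a = - a" for a :: "'g fword \<Rightarrow>\<^sub>0 'k"
    using abelian_group.minus_equality[OF ring.is_abelian_group[OF ring_free_algebra], of "- a" a]
    by (simp add: a_inv_def)
  show "subgroup {a. \<forall>v\<in>carrier M. action v a = \<zero>\<^bsub>M\<^esub>} (add_monoid free_algebra)"
    by (rule subgroup.intro, unfold inv_eq)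
      (auto simp: action_zero action_add_right action_uminus)
  show "a \<otimes>\<^bsub>free_algebra\<^esub> x \<in> {a. \<forall>v\<in>carrier M. action v a = \<zero>\<^bsub>M\<^esub>}"
    if "a \<in> {a. \<forall>v\<in>carrier M. action v a = \<zero>\<^bsub>M\<^esub>}" for a x
    using that by (auto simp: action_mult action_zero_left)
  show "x \<otimes>\<^bsub>free_algebra\<^esub> a \<in> {a. \<forall>v\<in>carrier M. action v a = \<zero>\<^bsub>M\<^esub>}"
    if "a \<in> {a. \<forall>v\<in>carrier M. action v a = \<zero>\<^bsub>M\<^esub>}" for a x
    using that by (auto simp: action_mult action_closed)
qed

end

section \<open>Descent of the action to the presented algebra\<close>

locale presented_algebra_operators = free_algebra_operators M op
  for M :: "('k::comm_ring_1, 'm) module" and op :: "'g \<Rightarrow> 'm \<Rightarrow> 'm" +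
  fixes rels :: "('g fword \<Rightarrow>\<^sub>0 'k) set"
  assumes relator_action: "\<lbrakk>r \<in> rels; v \<in> carrier M\<rbrakk> \<Longrightarrow> action v r = \<zero>\<^bsub>M\<^esub>"
begin

abbreviation relation_ideal :: "('g fword \<Rightarrow>\<^sub>0 'k) set" where
  "relation_ideal \<equiv> Idl\<^bsub>free_algebra\<^esub> rels"

abbreviation coset :: "('g fword \<Rightarrow>\<^sub>0 'k) \<Rightarrow> ('g fword \<Rightarrow>\<^sub>0 'k) set" where
  "coset a \<equiv> relation_ideal +>\<^bsub>free_algebra\<^esub> a"

lemma relation_ideal_algebra_ideal: "algebra_ideal relation_ideal free_algebra class_ring"
  by (intro algebra_ideal.intro assoc_algebra_free_algebra
      ring.genideal_ideal[OF ring_free_algebra]) simp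

lemma coset_in_carrier: "coset a \<in> carrier (presented_algebra rels)"
  unfolding presented_algebra_def
  by (rule algebra_ideal.coset_closed[OF relation_ideal_algebra_ideal]) simp

text \<open>The chosen representative differs from \<open>a\<close> by an element of the ideal
  generated by the relators. That ideal lies in the annihilator, which is an ideal containing all
  relators, so the difference acts as zero.\<close>

lemma presented_action_coset:
  assumes v: "v \<in> carrier M"
  shows "presented_action M op v (coset a) = action v a"
proof -
  interpret I: algebra_ideal relation_ideal free_algebra class_ring by (rule relation_ideal_algebra_ideal)
  have "a \<in> coset a"
    using I.a_rcos_self[of a] by simp
  then have "(SOME b. b \<in> coset a) \<in> coset a"
    by (rule someI)
  then obtain h where h: "h \<in> relation_ideal" "(SOME b. b \<in> coset a) = h + a"
    by (auto simp: a_r_coset_def r_coset_def)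
  have "relation_ideal \<subseteq> {a. \<forall>v\<in>carrier M. action v a = \<zero>\<^bsub>M\<^esub>}"
    by (rule ring.genideal_minimal[OF ring_free_algebra ideal_annihilator])
      (auto simp: relator_action)
  with h v show ?thesis
    by (auto simp: presented_action_def action_add_right action_closed)
qed

lemma right_module_presented:
  "right_module class_ring (presented_algebra rels) M (presented_action M op)"
proof -
  interpret I: algebra_ideal relation_ideal free_algebra class_ring by (rule relation_ideal_algebra_ideal)
  have carrierE: "\<exists>a. C = coset a" if "C \<in> carrier (presented_algebra rels)" for C
    using I.quotient_algebra_carrierE[of C] that unfolding presented_algebra_def by blast
  note simps = presented_algebra_def I.quotient_algebra_simps(2-) I.smult_coset
  have add: "coset a \<oplus>\<^bsub>presented_algebra rels\<^esub> coset b = coset (a + b)"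
    and mult: "coset a \<otimes>\<^bsub>presented_algebra rels\<^esub> coset b = coset (a * b)"
    and smult: "c \<odot>\<^bsub>presented_algebra rels\<^esub> coset a = coset (free_scale c a)"
    and one: "\<one>\<^bsub>presented_algebra rels\<^esub> = coset 1" for a b c
    by (simp_all add: simps)
  show ?thesis
  proof (rule right_module.intro)
    show "assoc_algebra class_ring (presented_algebra rels)"
      unfolding presented_algebra_def by (rule I.assoc_algebra_quotient)
    show "Module.module class_ring M"
      by (rule module_axioms)
  qed (drule carrierE | elim exE |
      simp add: add mult smult one presented_action_coset action_closed action_add_left
        action_add_right action_mult action_one action_free_scale)+
qed

text \<open>Submodules are defined as additive subgroups stable under the algebra. Stability under
  scalars follows because \<open>c\<close> acts as the coset of \<open>free_scale c 1\<close>, and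
  each operator is the action of the coset of a generator.\<close>

lemma right_submodule_closed:
  assumes N: "right_submodule N (presented_algebra rels) M (presented_action M op)"
    and v: "v \<in> N"
  shows "op g v \<in> N" "c \<odot>\<^bsub>M\<^esub> v \<in> N"
proof -
  have "v \<in> carrier M"
    using N v additive_subgroup.a_Hcarr unfolding right_submodule_def by metis
  moreover have "presented_action M op v (coset a) \<in> N" for a
    using N v coset_in_carrier by (auto simp: right_submodule_def)
  ultimately have "action v a \<in> N" for a
    by (metis presented_action_coset)
  from this[of "free_gen g"] this[of "free_scale c 1"] \<open>v \<in> carrier M\<close>
  show "op g v \<in> N" "c \<odot>\<^bsub>M\<^esub> v \<in> N"
    by (simp_all add: action_free_gen action_free_scale action_one)
qed

end

section \<open>The module V2\<close>

lemma V2_basis_action_closed: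
  "V2_basis_action p q l \<mu> lam g k \<in> carrier_vec l"
  by (cases g) auto

lemma V2_operator_index:
  assumes "i < l"
  shows "V2_operator p q l \<mu> lam g v $ i
    = (\<Sum>k<l. v $ k * V2_basis_action p q l \<mu> lam g k $ i)"
proof -
  interpret vec_space "TYPE('a)" l .
  have "V2_operator p q l \<mu> lam g v $ i
      = (\<Sum>k<l. (v $ k \<cdot>\<^sub>v V2_basis_action p q l \<mu> lam g k) $ i)"
    unfolding V2_operator_def module_vec_simps finsum_vec[symmetric]
    using assms V2_basis_action_closed[of p q l \<mu> lam g] by (intro index_finsum_vec) auto
  then show ?thesis
    using assms carrier_vecD[OF V2_basis_action_closed, of p q l \<mu> lam g] by simp
qed

lemma V2_operator_closed: "V2_operator p q l \<mu> lam g v \<in> carrier_vec l"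
proof -
  interpret vec_space "TYPE('a)" l .
  show ?thesis
    unfolding V2_operator_def module_vec_simps finsum_vec[symmetric]
    using V2_basis_action_closed[of p q l \<mu> lam g] by (intro finsum_vec_closed) auto
qed

lemma V2_operator_Z:
  "V2_operator p q l \<mu> lam Z v = vec l (\<lambda>i. inverse p ^ i * lam * v $ i)"
proof (rule eq_vecI)
  fix i assume "i < dim_vec (vec l (\<lambda>i. inverse p ^ i * lam * v $ i))"
  then have i: "i < l" by simp
  have "V2_operator p q l \<mu> lam Z v $ i
      = (\<Sum>k<l. if k = i then inverse p ^ i * lam * v $ i else 0)"
    unfolding V2_operator_index[OF i] using i by (intro sum.cong) auto
  then show "V2_operator p q l \<mu> lam Z v $ i = vec l (\<lambda>i. inverse p ^ i * lam * v $ i) $ i"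
    using i by simp
qed (simp add: carrier_vecD[OF V2_operator_closed])

text \<open>As \<open>y\<close> moves each basis vector one place forward, coordinate
  \<open>i\<close> of the image reads the cyclic predecessor of \<open>i\<close>.\<close>

lemma V2_operator_Y:
  "V2_operator p q l \<mu> lam Y v = vec l (\<lambda>i. \<mu> * v $ (if i = 0 then l - 1 else i - 1))"
    (is "_ = vec l ?f")
proof (rule eq_vecI)
  fix i assume "i < dim_vec (vec l ?f)"
  then have i: "i < l" by simp
  have "V2_operator p q l \<mu> lam Y v $ i
      = (\<Sum>k<l. if k = (if i = 0 then l - 1 else i - 1) then ?f i else 0)"
    unfolding V2_operator_index[OF i] using i by (intro sum.cong) auto
  then show "V2_operator p q l \<mu> lam Y v $ i = vec l ?f $ i"
    using i by (cases i) auto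
qed (simp add: carrier_vecD[OF V2_operator_closed])

text \<open>As \<open>x\<close> moves basis vectors one place back, coordinate \<open>i\<close>
  reads \<open>i + 1\<close>. The last coordinate is 0: \<open>x\<close> kills \<open>v 0\<close>
  instead of wrapping around.\<close>

lemma V2_operator_X:
  "V2_operator p q l \<mu> lam X v =
    vec l (\<lambda>i. if i + 1 < l then inverse \<mu> * lam * pq_number p q (i + 1) * v $ (i + 1) else 0)"
    (is "_ = vec l ?f")
proof (rule eq_vecI)
  fix i assume "i < dim_vec (vec l ?f)"
  then have i: "i < l" by simp
  have "V2_operator p q l \<mu> lam X v $ i = (\<Sum>k<l. if k = i + 1 then ?f i else 0)"
    unfolding V2_operator_index[OF i] using i by (intro sum.cong) auto
  then show "V2_operator p q l \<mu> lam X v $ i = vec l ?f $ i"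
    using i by simp
qed (simp add: carrier_vecD[OF V2_operator_closed])

lemmas V2_operator_simps = V2_operator_X V2_operator_Y V2_operator_Z

lemma free_algebra_operators_V2:
  "free_algebra_operators (V2 l) (V2_operator p q l \<mu> lam)"
proof -
  interpret vec_space "TYPE('a)" l .
  have "Module.module class_ring (V2 l :: ('a, 'a vec) module)"
    by (rule module_axioms)
  moreover have "free_algebra_operators_axioms (V2 l) (V2_operator p q l \<mu> lam)"
  proof
    fix g v w c
    assume v: "v \<in> carrier (V2 l :: ('a, 'a vec) module)"
    show "V2_operator p q l \<mu> lam g v \<in> carrier (V2 l)"
      by (simp add: module_vec_simps V2_operator_closed)
    show "V2_operator p q l \<mu> lam g (c \<odot>\<^bsub>V2 l\<^esub> v) = c \<odot>\<^bsub>V2 l\<^esub> V2_operator p q l \<mu> lam g v"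
      using v by (cases g) (auto simp: module_vec_simps V2_operator_simps)
    assume w: "w \<in> carrier (V2 l :: ('a, 'a vec) module)"
    show "V2_operator p q l \<mu> lam g (v \<oplus>\<^bsub>V2 l\<^esub> w)
        = V2_operator p q l \<mu> lam g v \<oplus>\<^bsub>V2 l\<^esub> V2_operator p q l \<mu> lam g w"
      using v w by (cases g) (auto simp: module_vec_simps V2_operator_simps algebra_simps)
  qed
  ultimately show ?thesis
    by (rule free_algebra_operators.intro)
qed

section \<open>The defining relations hold on V2\<close>

text \<open>This recursion is the relation \<open>yx - qxy = z\<close> read off on a basis vector:
  \<open>yx\<close>, \<open>xy\<close> and \<open>z\<close> scale \<open>v k\<close> by
  \<open>lam\<close> times \<open>[k+1]\<close>, \<open>[k]\<close> and
  \<open>inverse p ^ k\<close>, away from the last index.\<close>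

lemma pq_number_Suc:
  assumes "q \<noteq> inverse p"
  shows "pq_number p q (Suc k) = q * pq_number p q k + inverse p ^ k"
proof -
  have "(q ^ Suc k - r ^ Suc k) / (q - r) = q * ((q ^ k - r ^ k) / (q - r)) + r ^ k"
    if "q - r \<noteq> 0" for r
    using that by (simp add: divide_simps) (simp add: algebra_simps)
  from this[of "inverse p"] show ?thesis
    using assms by (simp add: pq_number_def)
qed

lemma pq_number_0 [simp]: "pq_number p q 0 = 0"
  by (simp add: pq_number_def)

text \<open>The relations are checked coordinate by coordinate. Away from the wrap-around they are
  immediate or the recursion for \<open>pq_number\<close>; at the wrap-around they need
  \<open>p ^ l = q ^ l = 1\<close>.\<close>

lemma presented_algebra_operators_V2:
  fixes p q \<mu> lam :: "'k::field"
  assumes p: "p \<noteq> 0" and pq: "p * q \<noteq> 1" and \<mu>: "\<mu> \<noteq> 0"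
    and pl: "p ^ l = 1" and ql: "q ^ l = 1" and l: "l > 0"
  shows "presented_algebra_operators (V2 l) (V2_operator p q l \<mu> lam)
    {free_gen Z * free_gen X - free_scale (inverse p) (free_gen X * free_gen Z),
     free_gen Z * free_gen Y - free_scale p (free_gen Y * free_gen Z),
     free_gen Y * free_gen X - free_scale q (free_gen X * free_gen Y) - free_gen Z}"
    (is "presented_algebra_operators _ ?op ?rels")
proof -
  interpret free_algebra_operators "V2 l :: ('k, 'k vec) module" ?op
    by (rule free_algebra_operators_V2)
  interpret V: vec_space "TYPE('k)" l .
  have qp: "q \<noteq> inverse p"
    using pq p by auto
  obtain n where n: "l = Suc n"
    using l by (cases l) auto
  \<comment> \<open>With \<open>n = l - 1\<close>, this gives \<open>zy = pyz\<close> where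
    \<open>y\<close> sends the last basis vector to the first.\<close>
  have pn: "inverse p ^ n = p"
  proof -
    have "p ^ n * p = 1" using pl n by (simp add: mult.commute)
    then show ?thesis using p by (simp add: power_inverse field_simps)
  qed
  \<comment> \<open>The left side is \<open>[l]\<close>, by the recursion at \<open>l - 1\<close>.
    Its vanishing matches the fact that \<open>y\<close> followed by \<open>x\<close> kills the last
    basis vector.\<close>
  have qn: "q * pq_number p q n + inverse p ^ n = 0"
  proof -
    have "pq_number p q l = 0"
      using pl ql by (simp add: pq_number_def power_inverse)
    then show ?thesis
      using pq_number_Suc[OF qp, of n] by (simp add: n)
  qed
  have carr: "?op g v \<in> carrier (V2 l)" for g v
    by (simp add: module_vec_simps V2_operator_closed)
  \<comment> \<open>In a right module the word \<open>zx\<close> applies \<open>z\<close> first, so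
    the order of the operators is reversed.\<close>
  have ZX: "?op X (?op Z v) = inverse p \<cdot>\<^sub>v ?op Z (?op X v)" for v
    using p by (auto simp: V2_operator_simps power_inverse field_simps)
  have ZY: "?op Y (?op Z v) = p \<cdot>\<^sub>v ?op Z (?op Y v)" for v
  proof (rule eq_vecI)
    fix i assume "i < dim_vec (p \<cdot>\<^sub>v ?op Z (?op Y v))"
    then show "?op Y (?op Z v) $ i = (p \<cdot>\<^sub>v ?op Z (?op Y v)) $ i"
      using p pn n by (cases i) (auto simp: V2_operator_simps)
  qed (simp add: V2_operator_simps)
  have YX: "?op X (?op Y v) = q \<cdot>\<^sub>v ?op Y (?op X v) + ?op Z v" for v
  proof (rule eq_vecI)
    fix i assume "i < dim_vec (q \<cdot>\<^sub>v ?op Y (?op X v) + ?op Z v)"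
    then have i: "i < l" by (simp add: V2_operator_simps)
    have "(if i = n then 0 else pq_number p q (Suc i)) = q * pq_number p q i + inverse p ^ i"
      using qn pq_number_Suc[OF qp, of i] by auto
    then have "?op X (?op Y v) $ i = (q * pq_number p q i + inverse p ^ i) * lam * v $ i"
      using \<mu> i n by (auto simp: V2_operator_simps split: if_splits)
    then show "?op X (?op Y v) $ i = (q \<cdot>\<^sub>v ?op Y (?op X v) + ?op Z v) $ i"
      using \<mu> i n by (cases i) (auto simp: V2_operator_simps algebra_simps)
  qed (simp add: V2_operator_simps)
  have minus_eq: "v \<ominus>\<^bsub>V2 l\<^esub> w = v - w" if "v \<in> carrier_vec l" "w \<in> carrier_vec l" for v w :: "'k vec"
    using that V.vec_neg[of w] by (simp add: a_minus_def module_vec_simps minus_add_uminus_vec)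
  have cancel: "v + w - v - w = 0\<^sub>v l" if "v \<in> carrier_vec l" "w \<in> carrier_vec l" for v w :: "'k vec"
    using that by (intro eq_vecI) auto
  have "action v r = \<zero>\<^bsub>V2 l\<^esub>" if r: "r \<in> ?rels" and v: "v \<in> carrier (V2 l)" for r v
    using r unfolding insert_iff empty_iff
    by (elim disjE; hypsubst?; simp only: v action_diff action_mult action_free_gen action_free_scale
        action_closed carr ZX ZY YX module_vec_simps(2,4))
      (simp_all add: minus_eq cancel V2_operator_closed)
  then show ?thesis
    by unfold_locales
qed

section \<open>Eigenvalues determine the index modulo the lcm\<close>

text \<open>The common denominator \<open>q - inverse p\<close> is nonzero because
  \<open>p * q \<noteq> 1\<close>. So the numerators agree, and the equal powers of
  \<open>inverse p\<close> cancel.\<close>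

lemma pq_number_eqD:
  fixes p q lam :: "'k::field"
  assumes "inverse p ^ i = inverse p ^ j" "pq_number p q i = pq_number p q j" "p * q \<noteq> 1" "p \<noteq> 0"
  shows "q ^ i = q ^ j"
proof -
  have "q - inverse p \<noteq> 0"
    using assms by auto
  then show ?thesis
    using assms by (simp add: pq_number_def)
qed

lemma primitive_root_dvd:
  assumes "primitive_root_of_unity n a" "a ^ k = 1"
  shows "n dvd k"
proof (rule ccontr)
  assume "\<not> n dvd k"
  then have "0 < k mod n"
    by (simp add: mod_greater_zero_iff_not_dvd)
  moreover have "k mod n < n"
    using assms by (simp add: primitive_root_of_unity_def)
  moreover have "a ^ k = (a ^ n) ^ (k div n) * a ^ (k mod n)"
    by (simp flip: power_mult power_add)
  ultimately show False
    using assms by (auto simp: primitive_root_of_unity_def)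
qed

text \<open>For \<open>i \<le> j\<close>, both roots have power 1 at \<open>j - i\<close>, so the
  lcm of the orders divides \<open>j - i\<close>, which is smaller than it.\<close>

lemma primitive_root_lcm_inj:
  fixes p q :: "'k::field"
  assumes p: "primitive_root_of_unity m p" and q: "primitive_root_of_unity n q"
    and "p \<noteq> 0" "q \<noteq> 0"
    and "p ^ i = p ^ j" "q ^ i = q ^ j" "i < lcm m n" "j < lcm m n"
  shows "i = j"
  using assms
proof (induction i j rule: linorder_wlog)
  case (le i j)
  have "p ^ (j - i) = 1" "q ^ (j - i) = 1"
    using le by (simp_all add: power_diff)
  then have "m dvd j - i" "n dvd j - i"
    using le primitive_root_dvd by blast+
  then have "lcm m n dvd j - i"
    by (rule lcm_least)
  moreover have "j - i < lcm m n"
    using le by simp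
  ultimately show ?case
    using le dvd_imp_le[of "lcm m n" "j - i"] by fastforce
next
  case (sym i j)
  then show ?case by metis
qed

section \<open>Subspaces stable under diagonal operators\<close>

text \<open>Induction on the size of the support. While two indices remain, some operator in
  \<open>D\<close> separates them and yields a nonzero vector of smaller support; a vector supported
  at one index is rescaled to a unit vector.\<close>

lemma unit_vec_in_diagonal_invariant:
  fixes N :: "'k::field vec set" and D :: "(nat \<Rightarrow> 'k) set"
  assumes N: "N \<subseteq> carrier_vec l"
    and add: "\<And>v w. \<lbrakk>v \<in> N; w \<in> N\<rbrakk> \<Longrightarrow> v + w \<in> N"
    and smult: "\<And>c v. v \<in> N \<Longrightarrow> c \<cdot>\<^sub>v v \<in> N"
    and diag: "\<And>d v. \<lbrakk>d \<in> D; v \<in> N\<rbrakk> \<Longrightarrow> vec l (\<lambda>i. d i * v $ i) \<in> N"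
    and sep: "\<And>i j. \<lbrakk>i < l; j < l; i \<noteq> j\<rbrakk> \<Longrightarrow> \<exists>d\<in>D. d i \<noteq> d j"
    and "v \<in> N" "v \<noteq> 0\<^sub>v l"
  shows "\<exists>k<l. unit_vec l k \<in> N"
  using \<open>v \<in> N\<close> \<open>v \<noteq> 0\<^sub>v l\<close>
proof (induction "card {i. i < l \<and> v $ i \<noteq> 0}" arbitrary: v rule: less_induct)
  case less
  have dim: "dim_vec v = l"
    using less.prems N by auto
  obtain j where j: "j < l" "v $ j \<noteq> 0"
    using less.prems dim by (metis eq_vecI index_zero_vec)
  show ?case
  proof (cases "\<exists>i<l. i \<noteq> j \<and> v $ i \<noteq> 0")
    case True
    then obtain i d where i: "i < l" "i \<noteq> j" "v $ i \<noteq> 0" and d: "d \<in> D" "d i \<noteq> d j"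
      using sep j(1) by metis
    \<comment> \<open>Coordinate \<open>k\<close> is multiplied by \<open>d k - d i\<close>: index
      \<open>i\<close> leaves the support, while index \<open>j\<close> stays since
      \<open>d i \<noteq> d j\<close>.\<close>
    define w where "w = vec l (\<lambda>k. d k * v $ k) + (- d i) \<cdot>\<^sub>v v"
    have w: "w \<in> N"
      using less.prems d add diag smult by (simp add: w_def)
    have w_index: "w $ k = (d k - d i) * v $ k" if "k < l" for k
      using that dim by (simp add: w_def algebra_simps)
    have "w \<noteq> 0\<^sub>v l"
      using w_index[OF j(1)] j d by auto
    moreover have "{k. k < l \<and> w $ k \<noteq> 0} \<subset> {k. k < l \<and> v $ k \<noteq> 0}"
    proof (rule psubsetI)
      show "{k. k < l \<and> w $ k \<noteq> 0} \<subseteq> {k. k < l \<and> v $ k \<noteq> 0}"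
        by (auto simp: w_index)
      have "w $ i = 0"
        using w_index[OF i(1)] by simp
      then show "{k. k < l \<and> w $ k \<noteq> 0} \<noteq> {k. k < l \<and> v $ k \<noteq> 0}"
        using i by blast
    qed
    then have "card {k. k < l \<and> w $ k \<noteq> 0} < card {k. k < l \<and> v $ k \<noteq> 0}"
      by (rule psubset_card_mono[rotated]) simp
    ultimately show ?thesis
      using less.hyps w by blast
  next
    case False
    then have "inverse (v $ j) \<cdot>\<^sub>v v = unit_vec l j"
      using j dim by (intro eq_vecI) auto
    then show ?thesis
      using smult[OF less.prems(1), of "inverse (v $ j)"] j(1) by auto
  qed
qed

lemma carrier_vec_subset_if_unit_vecs:
  fixes N :: "'k::field vec set"
  assumes zero: "0\<^sub>v l \<in> N"
    and add: "\<And>v w. \<lbrakk>v \<in> N; w \<in> N\<rbrakk> \<Longrightarrow> v + w \<in> N"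
    and smult: "\<And>c v. v \<in> N \<Longrightarrow> c \<cdot>\<^sub>v v \<in> N"
    and unit: "\<And>k. k < l \<Longrightarrow> unit_vec l k \<in> N"
  shows "carrier_vec l \<subseteq> N"
proof
  fix v :: "'k vec" assume v: "v \<in> carrier_vec l"
  \<comment> \<open>Truncations to the first \<open>m\<close> coordinates build up \<open>v\<close>
    one multiple of a unit vector at a time.\<close>
  have "vec l (\<lambda>i. if i < m then v $ i else 0) \<in> N" if "m \<le> l" for m
    using that
  proof (induction m)
    case 0
    then show ?case
      using zero by (simp add: zero_vec_def)
  next
    case (Suc m)
    have "vec l (\<lambda>i. if i < Suc m then v $ i else 0)
        = vec l (\<lambda>i. if i < m then v $ i else 0) + v $ m \<cdot>\<^sub>v unit_vec l m"
      using Suc.prems by (intro eq_vecI) (auto simp: less_Suc_eq)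
    then show ?case
      using Suc add smult unit by simp
  qed
  moreover have "vec l (\<lambda>i. if i < l then v $ i else 0) = v"
    using v by (intro eq_vecI) auto
  ultimately show "v \<in> N"
    by (metis order_refl)
qed

section \<open>Simplicity of V2\<close>

lemma V2_operator_Y_unit_vec:
  assumes "k < l"
  shows "V2_operator p q l \<mu> lam Y (unit_vec l k) = \<mu> \<cdot>\<^sub>v unit_vec l (Suc k mod l)"
  using assms by (cases "Suc k = l"; intro eq_vecI) (auto simp: V2_operator_Y)

text \<open>The factors \<mu> and \<open>inverse \<mu>\<close> cancel. At \<open>i = 0\<close> the
  left side reads the last coordinate after \<open>x\<close>, which is 0, in agreement with
  \<open>[0] = 0\<close>.\<close>

lemma V2_operator_Y_X:
  assumes "\<mu> \<noteq> 0"
  shows "V2_operator p q l \<mu> lam Y (V2_operator p q l \<mu> lam X v)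
    = vec l (\<lambda>i. lam * pq_number p q i * v $ i)"
proof (rule eq_vecI)
  fix i assume "i < dim_vec (vec l (\<lambda>i. lam * pq_number p q i * v $ i))"
  then show "V2_operator p q l \<mu> lam Y (V2_operator p q l \<mu> lam X v) $ i
      = vec l (\<lambda>i. lam * pq_number p q i * v $ i) $ i"
    using assms by (cases i) (auto simp: V2_operator_simps)
qed (simp add: V2_operator_simps)

lemma V2_invariant_subspace:
  fixes p q \<mu> lam :: "'k::field" and N :: "'k vec set"
  assumes p: "p \<noteq> 0" "primitive_root_of_unity m p" and q: "q \<noteq> 0" "primitive_root_of_unity n q"
    and pq: "p * q \<noteq> 1" and l: "l = lcm m n" and \<mu>: "\<mu> \<noteq> 0" and lam: "lam \<noteq> 0"
    and N: "N \<subseteq> carrier_vec l" "0\<^sub>v l \<in> N"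
    and add: "\<And>v w. \<lbrakk>v \<in> N; w \<in> N\<rbrakk> \<Longrightarrow> v + w \<in> N"
    and smult: "\<And>c v. v \<in> N \<Longrightarrow> c \<cdot>\<^sub>v v \<in> N"
    and op: "\<And>g v. v \<in> N \<Longrightarrow> V2_operator p q l \<mu> lam g v \<in> N"
  shows "N = {0\<^sub>v l} \<or> N = carrier_vec l"
proof (cases "N = {0\<^sub>v l}")
  case False
  then obtain v where v: "v \<in> N" "v \<noteq> 0\<^sub>v l"
    using N by blast
  \<comment> \<open>The eigenvalues of \<open>z\<close> and of \<open>xy\<close> on the basis
    vectors.\<close>
  let ?D = "{\<lambda>i. inverse p ^ i * lam, \<lambda>i. lam * pq_number p q i}"
  have "\<exists>k<l. unit_vec l k \<in> N"
  proof (rule unit_vec_in_diagonal_invariant[OF N(1) add smult _ _ v, where D = ?D])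
    show "vec l (\<lambda>i. d i * w $ i) \<in> N" if "d \<in> ?D" "w \<in> N" for d w
      using that op[of w Z] op[OF op, of w Y X]
      by (auto simp: V2_operator_Z V2_operator_Y_X[OF \<mu>])
    show "\<exists>d\<in>?D. d i \<noteq> d j" if ij: "i < l" "j < l" "i \<noteq> j" for i j
    proof (rule ccontr)
      assume "\<not> (\<exists>d\<in>?D. d i \<noteq> d j)"
      then have *: "inverse p ^ i = inverse p ^ j" "pq_number p q i = pq_number p q j"
        using lam by auto
      then have "p ^ i = p ^ j"
        by (simp add: power_inverse)
      moreover have "q ^ i = q ^ j"
        using * pq p(1) by (rule pq_number_eqD)
      ultimately show False
        using primitive_root_lcm_inj[OF p(2) q(2) p(1) q(1)] ij l by blast
    qed
  qed
  then obtain k where k: "k < l" "unit_vec l k \<in> N"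
    by blast
  have unit_add: "unit_vec l ((k + t) mod l) \<in> N" for t
  proof (induction t)
    case 0
    then show ?case
      using k by simp
  next
    case (Suc t)
    have "\<mu> \<cdot>\<^sub>v unit_vec l (Suc ((k + t) mod l) mod l) \<in> N"
      using op[OF Suc, of Y] k(1) V2_operator_Y_unit_vec[of "(k + t) mod l" l p q \<mu> lam] by simp
    from smult[OF this, of "inverse \<mu>"] show ?case
      using \<mu> by (simp add: smult_smult_assoc mod_Suc_eq)
  qed
  \<comment> \<open>Going from \<open>k\<close> to \<open>i\<close> takes \<open>l - k + i\<close>
    applications of \<open>y\<close>; adding \<open>l\<close> first keeps the subtraction of
    naturals exact when \<open>i < k\<close>.\<close>
  have "unit_vec l i \<in> N" if "i < l" for i
    using unit_add[of "l - k + i"] k(1) that by simp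
  then have "carrier_vec l \<subseteq> N"
    using carrier_vec_subset_if_unit_vecs[OF N(2) add smult] by blast
  then show ?thesis
    using N by blast
qed simp

theorem theorem5p2:
  fixes p q \<mu> lam :: "'k::alg_closed_field" and m n l :: nat
  assumes "p \<noteq> 0" and "q \<noteq> 0" and "p * q \<noteq> 1"
    and "primitive_root_of_unity m p" and "primitive_root_of_unity n q"
    and "l = lcm m n"
    and "\<mu> \<noteq> 0" and "lam \<noteq> 0"
  shows "simple_right_module class_ring (H p q) (V2 l) (V2_action p q l \<mu> lam) \<and>
    vectorspace.fin_dim class_ring (V2 l :: ('k, 'k vec) module) \<and>
    vectorspace.dim class_ring (V2 l :: ('k, 'k vec) module) = l"
proof (intro conjI)
  interpret V: vec_space "TYPE('k)" l .
  show "V.fin_dim" "V.dim = l"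
    by (rule V.fin_dim, rule V.dim_is_n)
  have m: "m > 0" "p ^ m = 1" and n: "n > 0" "q ^ n = 1"
    using assms(4,5) by (auto simp: primitive_root_of_unity_def)
  have l: "l > 0" "m dvd l" "n dvd l"
    using m n assms(6) by (auto intro: lcm_pos_nat)
  \<comment> \<open>The relations rest on these two equations, as \<open>l\<close> is a common
    multiple of the orders; the separation of indices below \<open>l\<close> rests on
    \<open>l\<close> being the least one.\<close>
  have pl: "p ^ l = 1" and ql: "q ^ l = 1"
    using l(2,3) m(2) n(2) by (metis dvdE power_mult power_one)+
  let ?rels = "{free_gen Z * free_gen X - free_scale (inverse p) (free_gen X * free_gen Z),
     free_gen Z * free_gen Y - free_scale p (free_gen Y * free_gen Z),
     free_gen Y * free_gen X - free_scale q (free_gen X * free_gen Y) - free_gen Z}"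
  interpret presented_algebra_operators "V2 l :: ('k, 'k vec) module"
    "V2_operator p q l \<mu> lam" ?rels
    using assms(1,3,7) pl ql l(1) by (rule presented_algebra_operators_V2)
  show "simple_right_module class_ring (H p q) (V2 l) (V2_action p q l \<mu> lam)"
    unfolding H_def V2_action_def
  proof (rule simple_right_module.intro[OF right_module_presented], rule simple_right_module_axioms.intro)
    have "(unit_vec l 0 :: 'k vec) \<noteq> 0\<^sub>v l"
      using l(1) by (metis index_unit_vec(2) index_zero_vec(1) zero_neq_one)
    then show "carrier (V2 l :: ('k, 'k vec) module) \<noteq> {\<zero>\<^bsub>V2 l\<^esub>}"
      unfolding module_vec_simps by (metis singletonD unit_vec_carrier)
  next
    fix N assume N: "right_submodule N (presented_algebra ?rels) (V2 l)
      (presented_action (V2 l) (V2_operator p q l \<mu> lam))"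
    then have "additive_subgroup N (V2 l)"
      by (simp add: right_submodule_def)
    then interpret N: additive_subgroup N "V2 l" .
    show "N = {\<zero>\<^bsub>V2 l\<^esub>} \<or> N = carrier (V2 l)"
      unfolding module_vec_simps
      using assms(1,4,2,5,3,6-8)
    proof (rule V2_invariant_subspace)
      show "N \<subseteq> carrier_vec l" "0\<^sub>v l \<in> N"
        using N.a_subset N.zero_closed by (simp_all add: module_vec_simps)
      show "v + w \<in> N" if "v \<in> N" "w \<in> N" for v w
        using N.a_closed[OF that] by (simp add: module_vec_simps)
    qed (use right_submodule_closed[OF N] in \<open>auto simp: module_vec_simps\<close>)
  qed
qed

end
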